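(* Socle length $\mathbf{sx}$ satisfies the constructability, product, and initial condition axioms on finite groups. That is: (a) every finite group $G$ has a subnormal series $\mathbf{1}=G_n\lhd G_{n-1}\lhd\cdots\lhd G_0=G$ (some $n\ge 0$) with $\mathbf{sx}(G_i/G_{i+1})\le 1$ for all $0\le i<n$; (b) for all finite groups $H,K$, $\mathbf{sx}(H\times K)=\max(\mathbf{sx}(H),\mathbf{sx}(K))$; (c) $\mathbf{sx}(\mathbf{1})=0$ for the trivial group $\mathbf{1}$.
   Context: The socle $\mathrm{soc}(G)$ of a finite group $G$ is the subgroup generated by the minimal normal subgroups of $G$. The socle series is $V_0=\mathbf{1}$ and $V_{i+1}$ = the preimage of $\mathrm{soc}(G/V_i)$ under the quotient map $G\to G/V_i$; the socle length $\mathbf{sx}(G)$ is the least $\ell\ge 0$ with $V_\ell=G$. *)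

theory Defs
  imports "HOL-Algebra.Algebra"
begin

definition minimal_normal :: "('a, 'b) monoid_scheme \<Rightarrow> 'a set \<Rightarrow> bool" where
  "minimal_normal G N \<longleftrightarrow>
     N \<lhd> G \<and> N \<noteq> {\<one>\<^bsub>G\<^esub>} \<and> (\<forall>M. M \<lhd> G \<and> M \<subseteq> N \<longrightarrow> M = {\<one>\<^bsub>G\<^esub>} \<or> M = N)"

definition socle :: "('a, 'b) monoid_scheme \<Rightarrow> 'a set" where
  "socle G = generate G (\<Union> {N. minimal_normal G N})"

primrec socle_series :: "('a, 'b) monoid_scheme \<Rightarrow> nat \<Rightarrow> 'a set" where
  "socle_series G 0 = {\<one>\<^bsub>G\<^esub>}"
| "socle_series G (Suc i) =
     {g \<in> carrier G. socle_series G i #>\<^bsub>G\<^esub> g \<in> socle (G Mod socle_series G i)}"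

definition socle_length :: "('a, 'b) monoid_scheme \<Rightarrow> nat" where
  "socle_length G = (LEAST l. socle_series G l = carrier G)"

definition subnormal_series :: "('a, 'b) monoid_scheme \<Rightarrow> nat \<Rightarrow> (nat \<Rightarrow> 'a set) \<Rightarrow> bool" where
  "subnormal_series G n S \<longleftrightarrow>
     S 0 = carrier G \<and> S n = {\<one>\<^bsub>G\<^esub>} \<and>
     (\<forall>i\<le>n. subgroup (S i) G) \<and>
     (\<forall>i<n. S (Suc i) \<lhd> (G\<lparr>carrier := S i\<rparr>))"


text \<open>
  The least element in \<^const>\<open>socle_length\<close> is only meaningful if the socle series
  reaches \<^term>\<open>carrier G\<close>. For finite groups it does.
\<close>

lemma socle_normal:
  assumes "group G"
  shows "socle G \<lhd> G"
proof -
  interpret group G by fact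
  show ?thesis
    unfolding socle_def
  proof (rule normal_generateI)
    show "\<Union> {N. minimal_normal G N} \<subseteq> carrier G"
      by (auto simp: minimal_normal_def dest!: normal_imp_subgroup subgroup.subset)
    show "g \<otimes>\<^bsub>G\<^esub> h \<otimes>\<^bsub>G\<^esub> inv\<^bsub>G\<^esub> g \<in> \<Union> {N. minimal_normal G N}"
      if "h \<in> \<Union> {N. minimal_normal G N}" "g \<in> carrier G" for h g
      using that by (auto simp: minimal_normal_def intro: normal.inv_op_closed2)
  qed
qed

lemma socle_nontrivial:
  assumes "group G" "finite (carrier G)" "carrier G \<noteq> {\<one>\<^bsub>G\<^esub>}"
  shows "socle G \<noteq> {\<one>\<^bsub>G\<^esub>}"
proof -
  interpret group G by fact
  define A where "A = {N. N \<lhd> G \<and> N \<noteq> {\<one>\<^bsub>G\<^esub>}}"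
  have "A \<subseteq> Pow (carrier G)"
    by (auto simp: A_def dest!: normal_imp_subgroup subgroup.subset)
  then have "finite A"
    using assms(2) finite_subset by auto
  moreover have "carrier G \<in> A"
    using assms(3) by (simp add: A_def normal_inv_iff subgroup_self)
  ultimately obtain N where N: "N \<in> A" "\<And>M. M \<in> A \<Longrightarrow> M \<subseteq> N \<Longrightarrow> N = M"
    using finite_has_minimal[of A] by auto
  then have "minimal_normal G N"
    by (auto simp: A_def minimal_normal_def)
  then have sub: "N \<subseteq> socle G"
    unfolding socle_def by (auto intro: generate.incl)
  have "N \<lhd> G" "N \<noteq> {\<one>\<^bsub>G\<^esub>}"
    using N(1) by (auto simp: A_def)
  then have "\<one>\<^bsub>G\<^esub> \<in> N"
    by (simp add: normal_imp_subgroup subgroup.one_closed)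
  with sub \<open>N \<noteq> {\<one>\<^bsub>G\<^esub>}\<close> show ?thesis
    by auto
qed

lemma socle_series_normal:
  assumes "group G"
  shows "socle_series G i \<lhd> G"
proof (induction i)
  case 0
  interpret group G by fact
  show ?case by (simp add: one_is_normal)
next
  case (Suc i)
  let ?V = "socle_series G i"
  interpret V: normal ?V G by (fact Suc)
  interpret Q: group "G Mod ?V" by (rule V.factorgroup_is_group)
  interpret S: normal "socle (G Mod ?V)" "G Mod ?V"
    by (rule socle_normal) (rule Q.is_group)
  interpret h: group_hom G "G Mod ?V" "\<lambda>g. ?V #>\<^bsub>G\<^esub> g"
    by unfold_locales (rule V.r_coset_hom_Mod)
  have "subgroup {g \<in> carrier G. ?V #>\<^bsub>G\<^esub> g \<in> socle (G Mod ?V)} G"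
  proof (rule V.subgroupI)
    show "{g \<in> carrier G. ?V #>\<^bsub>G\<^esub> g \<in> socle (G Mod ?V)} \<noteq> {}"
      using h.hom_one S.one_closed V.is_monoid monoid.one_closed[of G] by auto
  next
    fix a assume "a \<in> {g \<in> carrier G. ?V #>\<^bsub>G\<^esub> g \<in> socle (G Mod ?V)}"
    then show "inv\<^bsub>G\<^esub> a \<in> {g \<in> carrier G. ?V #>\<^bsub>G\<^esub> g \<in> socle (G Mod ?V)}"
      using h.hom_inv[of a] S.m_inv_closed by auto
  next
    fix a b assume "a \<in> {g \<in> carrier G. ?V #>\<^bsub>G\<^esub> g \<in> socle (G Mod ?V)}"
      "b \<in> {g \<in> carrier G. ?V #>\<^bsub>G\<^esub> g \<in> socle (G Mod ?V)}"
    then show "a \<otimes>\<^bsub>G\<^esub> b \<in> {g \<in> carrier G. ?V #>\<^bsub>G\<^esub> g \<in> socle (G Mod ?V)}"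
      using h.hom_mult[of a b] S.m_closed by auto
  qed auto
  moreover have "x \<otimes>\<^bsub>G\<^esub> g \<otimes>\<^bsub>G\<^esub> inv\<^bsub>G\<^esub> x \<in> {g \<in> carrier G. ?V #>\<^bsub>G\<^esub> g \<in> socle (G Mod ?V)}"
    if "x \<in> carrier G" "g \<in> {g \<in> carrier G. ?V #>\<^bsub>G\<^esub> g \<in> socle (G Mod ?V)}" for x g
  proof -
    have "?V #>\<^bsub>G\<^esub> (x \<otimes>\<^bsub>G\<^esub> g \<otimes>\<^bsub>G\<^esub> inv\<^bsub>G\<^esub> x) =
        (?V #>\<^bsub>G\<^esub> x) \<otimes>\<^bsub>G Mod ?V\<^esub> (?V #>\<^bsub>G\<^esub> g) \<otimes>\<^bsub>G Mod ?V\<^esub> inv\<^bsub>G Mod ?V\<^esub> (?V #>\<^bsub>G\<^esub> x)"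
      using that h.hom_mult h.hom_inv by (simp del: mult_FactGroup)
    also have "\<dots> \<in> socle (G Mod ?V)"
      using that by (intro S.inv_op_closed2) (auto intro: h.hom_closed)
    finally show ?thesis
      using that by simp
  qed
  ultimately show ?case
    by (simp add: V.normal_inv_iff)
qed

lemma socle_series_psubset:
  assumes "group G" "finite (carrier G)" "socle_series G i \<noteq> carrier G"
  shows "socle_series G i \<subset> socle_series G (Suc i)"
proof -
  let ?V = "socle_series G i"
  interpret V: normal ?V G by (rule socle_series_normal) fact
  interpret Q: group "G Mod ?V" by (rule V.factorgroup_is_group)
  interpret S: normal "socle (G Mod ?V)" "G Mod ?V"
    by (rule socle_normal) (rule Q.is_group)
  have one: "?V \<in> socle (G Mod ?V)"
    using S.one_closed by simp
  then have sub: "?V \<subseteq> socle_series G (Suc i)"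
    using V.subset V.coset_join2[OF _ V.subgroup_axioms] by auto
  obtain g where g: "g \<in> carrier G" "g \<notin> ?V"
    using assms(3) V.subset by auto
  then have "?V #>\<^bsub>G\<^esub> g \<in> carrier (G Mod ?V)" "?V #>\<^bsub>G\<^esub> g \<noteq> ?V"
    using V.coset_join1[OF _ _ V.subgroup_axioms] by (auto simp: carrier_FactGroup)
  then have "carrier (G Mod ?V) \<noteq> {\<one>\<^bsub>G Mod ?V\<^esub>}"
    by auto
  then have "socle (G Mod ?V) \<noteq> {\<one>\<^bsub>G Mod ?V\<^esub>}"
    using assms(2) by (intro socle_nontrivial Q.is_group) (auto simp: carrier_FactGroup)
  then obtain C where C: "C \<in> socle (G Mod ?V)" "C \<noteq> ?V"
    using one by auto
  then obtain x where x: "x \<in> carrier G" "C = ?V #>\<^bsub>G\<^esub> x"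
    using S.subset by (auto simp: carrier_FactGroup)
  then have "x \<in> socle_series G (Suc i)" "x \<notin> ?V"
    using C V.coset_join2[OF _ V.subgroup_axioms] by auto
  with sub show ?thesis by blast
qed

lemma socle_series_reaches_carrier:
  assumes "group G" "finite (carrier G)"
  shows "\<exists>l. socle_series G l = carrier G"
proof (rule ccontr)
  assume neg: "\<not> ?thesis"
  have fin: "socle_series G i \<subseteq> carrier G" for i
    by (intro subgroup.subset normal_imp_subgroup socle_series_normal assms)
  have "i \<le> card (socle_series G i)" for i
  proof (induction i)
    case (Suc i)
    have "card (socle_series G i) < card (socle_series G (Suc i))"
      using neg assms fin by (intro psubset_card_mono socle_series_psubset)
        (auto intro: finite_subset[OF fin] simp del: socle_series.simps)
    with Suc show ?case by linarith
  qed simp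
  from this[of "Suc (card (carrier G))"] show False
    using card_mono[OF assms(2) fin[of "Suc (card (carrier G))"]] by linarith
qed

lemma socle_series_socle_length:
  assumes "group G" "finite (carrier G)"
  shows "socle_series G (socle_length G) = carrier G"
  unfolding socle_length_def
  by (rule LeastI_ex) (rule socle_series_reaches_carrier[OF assms])

end

theory Submission
  imports Defs
begin

text \<open>
  A surjective homomorphism sends a minimal normal subgroup to the trivial group or to a
  minimal normal subgroup, hence the socle into the socle. Applied to the two projections of
  \<open>H \<times> K\<close> this gives \<open>soc(H \<times> K) \<subseteq> soc H \<times> soc K\<close>; the converse holds because minimal normal
  subgroups of a factor stay minimal normal in the product. Since
  \<open>(H \<times> K) / (V \<times> W) \<cong> (H / V) \<times> (K / W)\<close>, the whole socle series is computed componentwise,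
  which gives the product axiom. Constructability follows from the existence of a composition
  series, because a simple group equals its socle.
\<close>

section \<open>Socles under homomorphisms\<close>

lemma (in group_hom) normal_vimage:
  assumes "M \<lhd> H"
  shows "{x \<in> carrier G. h x \<in> M} \<lhd> G"
proof -
  interpret M: normal M H by fact
  show ?thesis
    by (rule G.normal_invI, rule G.subgroupI)
      (auto intro: M.inv_op_closed2 exI[of _ "\<one>"])
qed

lemma (in group_hom) surj_image_normal:
  assumes "h ` carrier G = carrier H" "N \<lhd> G"
  shows "h ` N \<lhd> H"
  using normal.surj_hom_normal_subgroup[OF assms(2) group_hom_axioms assms(1)] .

text \<open>Pull a normal \<open>M\<close> inside the image of \<open>N\<close> back to
  \<open>G\<close> and intersect with \<open>N\<close>. Minimality of \<open>N\<close> makes this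
  intersection trivial or all of \<open>N\<close>, and \<open>M\<close> is its image because every
  element of \<open>M\<close> comes from \<open>N\<close>.\<close>

lemma (in group_hom) surj_image_minimal_normal:
  assumes surj: "h ` carrier G = carrier H"
    and N: "minimal_normal G N" and ne: "h ` N \<noteq> {\<one>\<^bsub>H\<^esub>}"
  shows "minimal_normal H (h ` N)"
  unfolding minimal_normal_def
proof (intro conjI allI impI)
  have nN: "N \<lhd> G"
    using N by (simp add: minimal_normal_def)
  then show "h ` N \<lhd> H"
    by (rule surj_image_normal[OF surj])
  fix M assume M: "M \<lhd> H \<and> M \<subseteq> h ` N"
  let ?P = "{x \<in> carrier G. h x \<in> M} \<inter> N"
  have "?P \<lhd> G"
    using M by (intro G.normal_subgroup_intersect normal_vimage nN) auto
  then have "?P = {\<one>} \<or> ?P = N"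
    using N by (auto simp: minimal_normal_def)
  moreover have "N \<subseteq> carrier G"
    using nN by (simp add: normal_imp_subgroup subgroup.subset)
  then have "M = h ` ?P"
    using M by fast
  ultimately show "M = {\<one>\<^bsub>H\<^esub>} \<or> M = h ` N"
    by force
qed (fact ne)

lemma Union_minimal_normal_subset: "\<Union> {N. minimal_normal G N} \<subseteq> carrier G"
  by (auto simp: minimal_normal_def dest!: normal_imp_subgroup subgroup.subset)

text \<open>A homomorphism maps a generated subgroup onto the one generated by the images, so
  checking generators suffices. Surjectivity is not built in, so that the embedding of a factor into
  a direct product is covered too.\<close>

lemma (in group_hom) image_socle_subset:
  assumes "\<And>N. minimal_normal G N \<Longrightarrow> h ` N \<subseteq> socle H"
  shows "h ` socle G \<subseteq> socle H"
proof -
  have "subgroup (socle H) H"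
    by (intro normal_imp_subgroup socle_normal H.is_group)
  moreover have "h ` \<Union> {N. minimal_normal G N} \<subseteq> socle H"
    using assms by auto
  ultimately show ?thesis
    unfolding socle_def[of G] generate_img[OF Union_minimal_normal_subset, symmetric]
    by (intro H.generate_subgroup_incl)
qed

lemma minimal_normal_subset_socle: "minimal_normal G N \<Longrightarrow> N \<subseteq> socle G"
  unfolding socle_def by (auto intro: generate.incl)

lemma (in group_hom) surj_image_socle:
  assumes "h ` carrier G = carrier H"
  shows "h ` socle G \<subseteq> socle H"
proof (rule image_socle_subset)
  fix N assume N: "minimal_normal G N"
  \<comment> \<open>This handles the case where \<open>h\<close> collapses \<open>N\<close> to the
    identity; otherwise the image is again minimal normal.\<close>
  have "{\<one>\<^bsub>H\<^esub>} \<subseteq> socle H"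
    using socle_normal[OF H.is_group] by (simp add: normal_imp_subgroup subgroup.one_closed)
  then show "h ` N \<subseteq> socle H"
    using surj_image_minimal_normal[OF assms N] minimal_normal_subset_socle by metis
qed

text \<open>Both \<open>f\<close> and its inverse are surjective homomorphisms, so each direction is
  an instance of \<open>surj_image_socle\<close>.\<close>

lemma iso_mem_socle_iff:
  assumes "group G" "group H" "f \<in> iso G H" "x \<in> carrier G"
  shows "f x \<in> socle H \<longleftrightarrow> x \<in> socle G"
proof
  have surj: "f ` carrier G = carrier H"
    using assms(3) by (simp add: iso_def bij_betw_def)
  interpret f: group_hom G H f
    using assms by (simp add: group_hom_def group_hom_axioms_def iso_imp_homomorphism)
  show "x \<in> socle G \<Longrightarrow> f x \<in> socle H"
    using f.surj_image_socle[OF surj] by blast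
  let ?g = "inv_into (carrier G) f"
  have g: "?g \<in> iso H G"
    using assms(1,3) by (rule group.iso_set_sym)
  then have surj_g: "?g ` carrier H = carrier G"
    by (simp add: iso_def bij_betw_def)
  interpret g: group_hom H G ?g
    using g assms by (simp add: group_hom_def group_hom_axioms_def iso_imp_homomorphism)
  have "?g (f x) = x"
    using assms(3,4) by (simp add: iso_def bij_betw_def)
  then show "f x \<in> socle H \<Longrightarrow> x \<in> socle G"
    using g.surj_image_socle[OF surj_g] by (metis image_subset_iff)
qed

text \<open>The first isomorphism theorem, in the shape of the recursion for
  \<open>socle_series\<close>: the quotient by the kernel can be replaced by any concrete model
  \<open>H\<close> of it.\<close>

lemma (in group_hom) coset_mem_socle_iff:
  assumes surj: "h ` carrier G = carrier H" and x: "x \<in> carrier G"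
  shows "kernel G H h #> x \<in> socle (G Mod kernel G H h) \<longleftrightarrow> h x \<in> socle H"
proof -
  let ?N = "kernel G H h"
  \<comment> \<open>The isomorphism in \<open>FactGroup_iso_set\<close> sends a coset to
    \<open>the_elem\<close> of its image under \<open>h\<close>, so that image must be identified as
    a singleton.\<close>
  have "h ` (?N #> x) = {h x}"
  proof (rule equalityI)
    show "h ` (?N #> x) \<subseteq> {h x}"
      using x by (auto simp: kernel_def r_coset_def)
    have "x \<in> ?N #> x"
      using x by (intro G.rcos_self subgroup_kernel)
    then show "{h x} \<subseteq> h ` (?N #> x)"
      by blast
  qed
  then have "the_elem (h ` (?N #> x)) = h x"
    by simp
  moreover have "?N #> x \<in> carrier (G Mod ?N)"
    using x by (simp add: carrier_FactGroup)
  ultimately show ?thesis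
    using iso_mem_socle_iff[OF normal.factorgroup_is_group[OF normal_kernel] H.is_group
        FactGroup_iso_set[OF surj]]
    by metis
qed

section \<open>Socle series and socle length of direct products\<close>

lemma minimal_normal_times_one:
  assumes "group H" "group K" "minimal_normal H N"
  shows "minimal_normal (H \<times>\<times> K) (N \<times> {\<one>\<^bsub>K\<^esub>})"
  unfolding minimal_normal_def
proof (intro conjI allI impI)
  interpret H: group H by fact
  interpret K: group K by fact
  interpret P: group "H \<times>\<times> K" by (intro DirProd_group assms)
  interpret p: group_hom "H \<times>\<times> K" H fst
    by unfold_locales (auto simp: hom_def)
  have surj: "fst ` carrier (H \<times>\<times> K) = carrier H"
    using K.one_closed by force
  have N: "N \<lhd> H" "N \<noteq> {\<one>\<^bsub>H\<^esub>}" "\<And>M. M \<lhd> H \<Longrightarrow> M \<subseteq> N \<Longrightarrow> M = {\<one>\<^bsub>H\<^esub>} \<or> M = N"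
    using assms(3) by (auto simp: minimal_normal_def)
  show "N \<times> {\<one>\<^bsub>K\<^esub>} \<lhd> H \<times>\<times> K"
    by (intro H.DirProd_normal K.one_is_normal assms N)
  show "N \<times> {\<one>\<^bsub>K\<^esub>} \<noteq> {\<one>\<^bsub>H \<times>\<times> K\<^esub>}"
    using N(2) by auto
  fix M assume M: "M \<lhd> H \<times>\<times> K \<and> M \<subseteq> N \<times> {\<one>\<^bsub>K\<^esub>}"
  \<comment> \<open>\<open>M\<close> is determined by its first projection, which is normal in
    \<open>H\<close> since \<open>fst\<close> is surjective; minimality of \<open>N\<close> then
    applies to it.\<close>
  then have "M = fst ` M \<times> {\<one>\<^bsub>K\<^esub>}"
    by force
  moreover have "fst ` M = {\<one>\<^bsub>H\<^esub>} \<or> fst ` M = N"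
    using M by (intro N p.surj_image_normal[OF surj]) auto
  ultimately have "M = {\<one>\<^bsub>H\<^esub>} \<times> {\<one>\<^bsub>K\<^esub>} \<or> M = N \<times> {\<one>\<^bsub>K\<^esub>}"
    by metis
  then show "M = {\<one>\<^bsub>H \<times>\<times> K\<^esub>} \<or> M = N \<times> {\<one>\<^bsub>K\<^esub>}"
    by simp
qed

lemma socle_times_one:
  assumes "group H" "group K" "x \<in> socle H"
  shows "(x, \<one>\<^bsub>K\<^esub>) \<in> socle (H \<times>\<times> K)"
proof -
  interpret H: group H by fact
  interpret K: group K by fact
  interpret P: group "H \<times>\<times> K" by (intro DirProd_group assms)
  interpret i: group_hom H "H \<times>\<times> K" "\<lambda>x. (x, \<one>\<^bsub>K\<^esub>)"
    by unfold_locales (auto simp: hom_def)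
  have "(\<lambda>x. (x, \<one>\<^bsub>K\<^esub>)) ` socle H \<subseteq> socle (H \<times>\<times> K)"
  proof (rule i.image_socle_subset)
    fix N assume "minimal_normal H N"
    then show "(\<lambda>x. (x, \<one>\<^bsub>K\<^esub>)) ` N \<subseteq> socle (H \<times>\<times> K)"
      using minimal_normal_subset_socle[OF minimal_normal_times_one[OF assms(1,2)]] by auto
  qed
  then show ?thesis
    using assms(3) by auto
qed

lemma socle_DirProd:
  assumes "group H" "group K"
  shows "socle (H \<times>\<times> K) = socle H \<times> socle K"
proof
  interpret H: group H by fact
  interpret K: group K by fact
  interpret P: group "H \<times>\<times> K" by (intro DirProd_group assms)
  interpret p: group_hom "H \<times>\<times> K" H fst
    by unfold_locales (auto simp: hom_def)
  interpret q: group_hom "H \<times>\<times> K" K snd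
    by unfold_locales (auto simp: hom_def)
  interpret S: normal "socle (H \<times>\<times> K)" "H \<times>\<times> K"
    by (intro socle_normal P.is_group)
  have "fst ` carrier (H \<times>\<times> K) = carrier H" "snd ` carrier (H \<times>\<times> K) = carrier K"
    using H.one_closed K.one_closed by force+
  then show "socle (H \<times>\<times> K) \<subseteq> socle H \<times> socle K"
    using p.surj_image_socle q.surj_image_socle by force
  show "socle H \<times> socle K \<subseteq> socle (H \<times>\<times> K)"
  proof clarify
    fix x y assume x: "x \<in> socle H" and y: "y \<in> socle K"
    have xy: "x \<in> carrier H" "y \<in> carrier K"
      using x y socle_normal[OF assms(1)] socle_normal[OF assms(2)]
      by (auto dest!: normal_imp_subgroup subgroup.subset)
    \<comment> \<open>Swapping the factors is an isomorphism, so the statement for the first factor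
      yields the one for the second.\<close>
    have "(\<lambda>(x, y). (y, x)) (y, \<one>\<^bsub>H\<^esub>) \<in> socle (H \<times>\<times> K)"
      using socle_times_one[OF assms(2,1) y] xy
      by (subst iso_mem_socle_iff[OF _ P.is_group DirProd_commute_iso_set])
        (auto intro: DirProd_group assms)
    then have "(x, \<one>\<^bsub>K\<^esub>) \<otimes>\<^bsub>H \<times>\<times> K\<^esub> (\<one>\<^bsub>H\<^esub>, y) \<in> socle (H \<times>\<times> K)"
      using socle_times_one[OF assms x] by (intro S.m_closed) auto
    then show "(x, y) \<in> socle (H \<times>\<times> K)"
      using xy by simp
  qed
qed

text \<open>Induction on \<open>i\<close>: the paired coset map \<open>?f\<close> is surjective with
  kernel \<open>?V \<times> ?W\<close>, so \<open>coset_mem_socle_iff\<close> moves the question to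
  a direct product of quotients, where \<open>socle_DirProd\<close> splits it.\<close>

lemma socle_series_DirProd:
  assumes "group H" "group K"
  shows "socle_series (H \<times>\<times> K) i = socle_series H i \<times> socle_series K i"
proof (induction i)
  case 0
  show ?case by simp
next
  case (Suc i)
  interpret H: group H by fact
  interpret K: group K by fact
  interpret P: group "H \<times>\<times> K" by (intro DirProd_group assms)
  let ?V = "socle_series H i" and ?W = "socle_series K i"
  interpret V: normal ?V H by (intro socle_series_normal assms)
  interpret W: normal ?W K by (intro socle_series_normal assms)
  let ?Q = "(H Mod ?V) \<times>\<times> (K Mod ?W)"
  let ?f = "\<lambda>(x, y). (?V #>\<^bsub>H\<^esub> x, ?W #>\<^bsub>K\<^esub> y)"
  interpret Q: group ?Q
    by (intro DirProd_group V.factorgroup_is_group W.factorgroup_is_group)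
  interpret f: group_hom "H \<times>\<times> K" ?Q ?f
    by unfold_locales
      (simp add: hom_paired2 assms V.r_coset_hom_Mod W.r_coset_hom_Mod)
  have surj: "?f ` carrier (H \<times>\<times> K) = carrier ?Q"
    by (auto simp: carrier_FactGroup image_paired_Times)
  have ker: "kernel (H \<times>\<times> K) ?Q ?f = ?V \<times> ?W"
    using H.coset_join1[OF _ _ V.subgroup_axioms] K.coset_join1[OF _ _ W.subgroup_axioms]
      H.coset_join2[OF _ V.subgroup_axioms] K.coset_join2[OF _ W.subgroup_axioms]
    by (auto simp: kernel_def)
  have soc: "socle ?Q = socle (H Mod ?V) \<times> socle (K Mod ?W)"
    by (intro socle_DirProd V.factorgroup_is_group W.factorgroup_is_group)
  have "(?V \<times> ?W) #>\<^bsub>H \<times>\<times> K\<^esub> (x, y) \<in> socle ((H \<times>\<times> K) Mod (?V \<times> ?W)) \<longleftrightarrow>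
      ?V #>\<^bsub>H\<^esub> x \<in> socle (H Mod ?V) \<and> ?W #>\<^bsub>K\<^esub> y \<in> socle (K Mod ?W)"
    if "x \<in> carrier H" "y \<in> carrier K" for x y
    using f.coset_mem_socle_iff[OF surj, of "(x, y)"] that unfolding ker soc by simp
  then show ?case
    unfolding socle_series.simps Suc by auto
qed

lemma socle_series_mono:
  assumes "group G" "socle_series G l = carrier G" "l \<le> m"
  shows "socle_series G m = carrier G"
  using assms(3)
proof (induction rule: dec_induct)
  case base
  show ?case by fact
next
  case (step n)
  interpret group G by fact
  interpret V: normal "carrier G" G by (rule normal_self)
  interpret S: normal "socle (G Mod carrier G)" "G Mod carrier G"
    by (intro socle_normal V.factorgroup_is_group)
  \<comment> \<open>The coset \<open>carrier G\<close> is the identity of this quotient, and every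
    element of \<open>G\<close> lies in it, so the next term is again everything.\<close>
  have "carrier G \<in> socle (G Mod carrier G)"
    using subgroup.one_closed[OF S.subgroup_axioms] by simp
  then show ?case
    using coset_join2[OF _ V.subgroup_axioms] by (auto simp: step)
qed

text \<open>Turns the \<open>LEAST\<close> into a threshold: by finiteness the series reaches
  \<open>carrier G\<close>, and from then on it stays there.\<close>

lemma socle_length_le_iff:
  assumes "group G" "finite (carrier G)"
  shows "socle_length G \<le> l \<longleftrightarrow> socle_series G l = carrier G"
proof
  show "socle_length G \<le> l \<Longrightarrow> socle_series G l = carrier G"
    using socle_series_mono[OF assms(1) socle_series_socle_length[OF assms]] .
  show "socle_series G l = carrier G \<Longrightarrow> socle_length G \<le> l"
    unfolding socle_length_def by (rule Least_le)
qed

lemma socle_length_DirProd: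
  assumes "group H" "finite (carrier H)" "group K" "finite (carrier K)"
  shows "socle_length (H \<times>\<times> K) = max (socle_length H) (socle_length K)"
proof -
  have ne: "carrier H \<noteq> {}" "carrier K \<noteq> {}"
    using assms(1,3) by (auto simp: group_def monoid.carrier_not_empty)
  have fin: "finite (carrier (H \<times>\<times> K))"
    using assms by simp
  \<comment> \<open>Both sides have the same upper bounds \<open>l\<close>. Nonempty carriers
    exclude the degenerate cases of \<open>times_eq_iff\<close>.\<close>
  have *: "socle_length (H \<times>\<times> K) \<le> l \<longleftrightarrow> socle_length H \<le> l \<and> socle_length K \<le> l" for l
    unfolding socle_length_le_iff[OF DirProd_group[OF assms(1,3)] fin]
      socle_length_le_iff[OF assms(1,2)] socle_length_le_iff[OF assms(3,4)]
      socle_series_DirProd[OF assms(1,3)] carrier_DirProd times_eq_iff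
    using ne by blast
  show ?thesis
  proof (rule order_antisym)
    show "socle_length (H \<times>\<times> K) \<le> max (socle_length H) (socle_length K)"
      unfolding * by simp
    show "max (socle_length H) (socle_length K) \<le> socle_length (H \<times>\<times> K)"
      using *[of "socle_length (H \<times>\<times> K)"] by simp
  qed
qed

section \<open>Constructability by maximal normal subgroups\<close>

lemma (in group) socle_series_one: "socle_series G 1 = socle G"
proof -
  \<comment> \<open>The quotient by \<open>{\<one>}\<close> consists of singletons; the identity
    map, with kernel \<open>{\<one>}\<close>, carries its socle back to \<open>G\<close>.\<close>
  have f: "group_hom G G (\<lambda>x. x)"
    by unfold_locales (simp add: hom_def)
  have "kernel G G (\<lambda>x. x) = {\<one>}"
    by (auto simp: kernel_def)
  then have "{\<one>} #> x \<in> socle (G Mod {\<one>}) \<longleftrightarrow> x \<in> socle G" if "x \<in> carrier G" for x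
    using group_hom.coset_mem_socle_iff[OF f _ that] by simp
  moreover have "socle G \<subseteq> carrier G"
    by (intro subgroup.subset normal_imp_subgroup socle_normal is_group)
  ultimately show ?thesis
    unfolding One_nat_def socle_series.simps by blast
qed

text \<open>The preimage \<open>?M\<close> of the socle of the quotient is normal and contains
  \<open>N\<close> properly, because a nontrivial finite group has nontrivial socle. Maximality
  gives \<open>?M = carrier G\<close>, so the series of the quotient is complete after one
  step.\<close>

lemma socle_length_Mod_maximal_normal:
  assumes "group G" "finite (carrier G)" "N \<lhd> G" "N \<noteq> carrier G"
    and max: "\<And>M. M \<lhd> G \<Longrightarrow> N \<subseteq> M \<Longrightarrow> M = N \<or> M = carrier G"
  shows "socle_length (G Mod N) \<le> 1"
proof -
  let ?Q = "G Mod N"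
  interpret N: normal N G by fact
  interpret Q: group ?Q by (rule N.factorgroup_is_group)
  interpret S: normal "socle ?Q" ?Q by (intro socle_normal Q.is_group)
  interpret q: group_hom G ?Q "\<lambda>x. N #>\<^bsub>G\<^esub> x"
    by unfold_locales (rule N.r_coset_hom_Mod)
  let ?M = "{x \<in> carrier G. N #>\<^bsub>G\<^esub> x \<in> socle ?Q}"
  have fin: "finite (carrier ?Q)"
    using assms(2) by (simp add: carrier_FactGroup)
  obtain g where "g \<in> carrier G" "g \<notin> N"
    using assms(4) N.subset by auto
  then have "carrier ?Q \<noteq> {\<one>\<^bsub>?Q\<^esub>}"
    using N.coset_join1[OF _ _ N.subgroup_axioms] by (auto simp: carrier_FactGroup)
  then have "socle ?Q \<noteq> {\<one>\<^bsub>?Q\<^esub>}"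
    by (intro socle_nontrivial Q.is_group fin)
  then obtain C where C: "C \<in> socle ?Q" "C \<noteq> N"
    using S.one_closed by auto
  then obtain x where x: "x \<in> carrier G" "C = N #>\<^bsub>G\<^esub> x"
    using S.subset by (auto simp: carrier_FactGroup)
  have "N \<subseteq> ?M"
    using S.one_closed N.coset_join2[OF _ N.subgroup_axioms] N.subset by auto
  moreover have "x \<in> ?M" "x \<notin> N"
    using C x N.coset_join2[OF _ N.subgroup_axioms] by auto
  ultimately have "?M = carrier G"
    using max[OF q.normal_vimage[OF S.normal_axioms]] by blast
  then have "socle ?Q = carrier ?Q"
    using S.subset by (auto simp: carrier_FactGroup)
  then show ?thesis
    by (simp only: socle_length_le_iff[OF Q.is_group fin] Q.socle_series_one)
qed

lemma ex_maximal_normal: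
  assumes "group G" "finite (carrier G)" "carrier G \<noteq> {\<one>\<^bsub>G\<^esub>}"
  obtains N where "N \<lhd> G" "N \<noteq> carrier G"
    "\<And>M. M \<lhd> G \<Longrightarrow> N \<subseteq> M \<Longrightarrow> M = N \<or> M = carrier G"
proof -
  interpret group G by fact
  define A where "A = {N. N \<lhd> G \<and> N \<noteq> carrier G}"
  have "A \<subseteq> Pow (carrier G)"
    by (auto simp: A_def dest!: normal_imp_subgroup subgroup.subset)
  then have "finite A"
    using assms(2) finite_subset by auto
  moreover have "{\<one>\<^bsub>G\<^esub>} \<in> A"
    using assms(3) by (simp add: A_def one_is_normal)
  ultimately obtain N where "N \<in> A" "\<And>M. M \<in> A \<Longrightarrow> N \<subseteq> M \<Longrightarrow> N = M"
    using finite_has_maximal[of A] by auto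
  then show thesis
    by (intro that[of N]) (auto simp: A_def)
qed

text \<open>Induction on the order: a series for a maximal normal subgroup \<open>N\<close> is
  extended at the top by \<open>G\<close>.\<close>

lemma ex_subnormal_series_socle_length_le_1:
  assumes "group G" "finite (carrier G)"
  shows "\<exists>n S. subnormal_series G n S \<and>
    (\<forall>i<n. socle_length ((G\<lparr>carrier := S i\<rparr>) Mod S (Suc i)) \<le> 1)"
  using assms
proof (induction "card (carrier G)" arbitrary: G rule: less_induct)
  case less
  interpret group G by fact
  show ?case
  proof (cases "carrier G = {\<one>\<^bsub>G\<^esub>}")
    case True
    then have "subnormal_series G 0 (\<lambda>_. carrier G)"
      by (simp add: subnormal_series_def triv_subgroup)
    then show ?thesis by blast
  next
    case False
    then obtain N where N: "N \<lhd> G" "N \<noteq> carrier G"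
      and max: "\<And>M. M \<lhd> G \<Longrightarrow> N \<subseteq> M \<Longrightarrow> M = N \<or> M = carrier G"
      using ex_maximal_normal[OF less.prems] by metis
    interpret N: normal N G by fact
    have "card N < card (carrier G)"
      using N(2) N.subset less.prems(2) by (intro psubset_card_mono) auto
    moreover have "group (G\<lparr>carrier := N\<rparr>)"
      by (intro subgroup_imp_group N.subgroup_axioms)
    moreover have "finite N"
      using N.subset less.prems(2) by (rule finite_subset)
    ultimately obtain n S where S: "subnormal_series (G\<lparr>carrier := N\<rparr>) n S"
      and len: "\<And>i. i < n \<Longrightarrow> socle_length ((G\<lparr>carrier := S i\<rparr>) Mod S (Suc i)) \<le> 1"
      using less.hyps[of "G\<lparr>carrier := N\<rparr>"] by auto
    \<comment> \<open>Prepends \<open>carrier G\<close> and shifts \<open>S\<close> by one index; as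
      \<open>S 0 = N\<close>, the new top factor is \<open>G Mod N\<close>.\<close>
    let ?T = "case_nat (carrier G) S"
    have S0: "S 0 = N"
      using S by (simp add: subnormal_series_def)
    have "subnormal_series G (Suc n) ?T"
      using S N incl_subgroup[OF N.subgroup_axioms] subgroup_self
      by (auto simp: subnormal_series_def split: nat.split)
    moreover have "socle_length ((G\<lparr>carrier := ?T i\<rparr>) Mod ?T (Suc i)) \<le> 1" if "i < Suc n" for i
      using that len socle_length_Mod_maximal_normal[OF less.prems N max]
      by (cases i) (auto simp: S0)
    ultimately show ?thesis by blast
  qed
qed

theorem proposition5p14:
  shows "(\<forall>G :: ('a, 'm) monoid_scheme. group G \<and> finite (carrier G) \<longrightarrow>
            (\<exists>n S. subnormal_series G n S \<and>
                   (\<forall>i<n. socle_length ((G\<lparr>carrier := S i\<rparr>) Mod S (Suc i)) \<le> 1)))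
       \<and> (\<forall>(H :: ('b, 'p) monoid_scheme) (K :: ('c, 'q) monoid_scheme).
            group H \<and> finite (carrier H) \<and> group K \<and> finite (carrier K) \<longrightarrow>
            socle_length (H \<times>\<times> K) = max (socle_length H) (socle_length K))
       \<and> (\<forall>T :: ('d, 'r) monoid_scheme. group T \<and> carrier T = {\<one>\<^bsub>T\<^esub>} \<longrightarrow> socle_length T = 0)"
proof (intro conjI allI impI)
  fix G :: "('a, 'm) monoid_scheme"
  assume "group G \<and> finite (carrier G)"
  then show "\<exists>n S. subnormal_series G n S \<and>
      (\<forall>i<n. socle_length ((G\<lparr>carrier := S i\<rparr>) Mod S (Suc i)) \<le> 1)"
    by (intro ex_subnormal_series_socle_length_le_1) auto
next
  fix H :: "('b, 'p) monoid_scheme" and K :: "('c, 'q) monoid_scheme"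
  assume "group H \<and> finite (carrier H) \<and> group K \<and> finite (carrier K)"
  then show "socle_length (H \<times>\<times> K) = max (socle_length H) (socle_length K)"
    by (intro socle_length_DirProd) auto
next
  fix T :: "('d, 'r) monoid_scheme"
  assume "group T \<and> carrier T = {\<one>\<^bsub>T\<^esub>}"
  then show "socle_length T = 0"
    \<comment> \<open>At threshold 0 the criterion asks that the zeroth term \<open>{\<one>}\<close>
      be the carrier.\<close>
    using socle_length_le_iff[of T 0] by simp
qed

end
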